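(* Let $r>0$ and let $S\subset\mathbb{R}^n$ be a nonempty, closed and $r$-spherically supported set. Then $S$ is $r$-strongly convex, or there exists a nonempty, closed and $r$-strongly convex set $A\subset\mathbb{R}^n$ such that $S\subset\operatorname{bdry} A$. In fact: if $\operatorname{int} S\neq\emptyset$, then $S$ is $r$-strongly convex; and if $\operatorname{int} S=\emptyset$, then there exists a nonempty, closed and $r$-strongly convex set $A\subset\mathbb{R}^n$ such that $S\subset\operatorname{bdry} A$.
   Context: $\mathbb{R}^n$ carries the usual inner product $\langle\cdot,\cdot\rangle$ and Euclidean norm $\|\cdot\|$; $\operatorname{int}$ and $\operatorname{bdry}$ denote topological interior and boundary. For a nonempty closed set $S\subset\mathbb{R}^n$ and $s\in S$, the proximal normal cone to $S$ at $s$ is $$N_S^P(s):=\{\zeta\in\mathbb{R}^n : \exists\,\sigma\ge 0 \text{ such that } \langle\zeta,x-s\rangle\le\sigma\|x-s\|^2\ \text{for all } x\in S\}.$$ For $s\in\operatorname{bdry} S$ and $r>0$, a nonzero vector $\zeta\in N_S^P(s)$ is said to be far realized by an $r$-sphere if $$\left\langle\frac{\zeta}{\|\zeta\|},x-s\right\rangle\le-\frac{1}{2r}\|x-s\|^2\quad\text{for all } x\in S,$$ equivalently, $S$ is contained in the closed ball of radius $r$ centered at $s-r\,\zeta/\|\zeta\|$. A nonempty closed set $S$ is $r$-spherically supported if for every $s\in\operatorname{bdry} S$ there exists a nonzero vector $\zeta\in N_S^P(s)$ that is far realized by an $r$-sphere. A nonempty closed set $S$ is $r$-strongly convex if for every $s\in\operatorname{bdry}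 S$, every nonzero vector $\zeta\in N_S^P(s)$ is far realized by an $r$-sphere. *)

theory Defs
  imports "HOL-Analysis.Analysis"
begin

definition proximal_normal_cone :: "'a::real_inner set \<Rightarrow> 'a \<Rightarrow> 'a set" where
  "proximal_normal_cone S s =
     {\<zeta>. \<exists>\<sigma>\<ge>0. \<forall>x\<in>S. \<zeta> \<bullet> (x - s) \<le> \<sigma> * (norm (x - s))\<^sup>2}"

(* The three predicates below are only meant for r > 0 and nonempty closed S, and
   far_realized only for s in the frontier of S and nonzero \<zeta> in the proximal
   normal cone; these side conditions are stated where the predicates are used. *)

definition far_realized :: "real \<Rightarrow> 'a::real_inner set \<Rightarrow> 'a \<Rightarrow> 'a \<Rightarrow> bool" where
  "far_realized r S s \<zeta> \<longleftrightarrow>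
     (\<forall>x\<in>S. (\<zeta> /\<^sub>R norm \<zeta>) \<bullet> (x - s) \<le> - (1 / (2 * r)) * (norm (x - s))\<^sup>2)"

definition spherically_supported :: "real \<Rightarrow> 'a::real_inner set \<Rightarrow> bool" where
  "spherically_supported r S \<longleftrightarrow>
     (\<forall>s\<in>frontier S. \<exists>\<zeta>\<in>proximal_normal_cone S s. \<zeta> \<noteq> 0 \<and> far_realized r S s \<zeta>)"

definition strongly_convex :: "real \<Rightarrow> 'a::real_inner set \<Rightarrow> bool" where
  "strongly_convex r S \<longleftrightarrow>
     (\<forall>s\<in>frontier S. \<forall>\<zeta>\<in>proximal_normal_cone S s. \<zeta> \<noteq> 0 \<longrightarrow> far_realized r S s \<zeta>)"

end

theory Submission
  imports Defs
begin

text \<open>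
  Let \<open>A\<close> be the intersection of all closed \<open>r\<close>-balls that contain \<open>S\<close>. Two facts about \<open>A\<close>
  give the theorem.

  First, any such intersection is \<open>r\<close>-strongly convex (\<open>strongly_convex_ball_hull\<close>). With two
  points \<open>a\<close> and \<open>x\<close>, it contains every parabolic arc that joins them and rises at most
  \<open>(norm (x - a))\<^sup>2 / (8 r)\<close> over the segment (\<open>bulged_segment_in_cball\<close>). If a normal \<open>\<zeta>\<close> at \<open>a\<close> were not far
  realized because of the point \<open>x\<close>, the arc from \<open>a\<close> to \<open>x\<close> that bulges in the direction \<open>\<zeta>\<close>
  would leave \<open>a\<close> at an acute angle with \<open>\<zeta>\<close> while staying in \<open>A\<close>, which no proximal normal
  allows.

  Second, if \<open>S\<close> is \<open>r\<close>-spherically supported, then \<open>frontier S \<subseteq> frontier A\<close>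
  (\<open>frontier_subset_frontier_ball_hull\<close>): the \<open>r\<close>-ball that supports \<open>S\<close> at \<open>s\<close> is one of the
  balls whose intersection is \<open>A\<close>, and \<open>s\<close> lies on its boundary sphere.

  If \<open>S\<close> has empty interior, then \<open>S = frontier S \<subseteq> frontier A\<close> and \<open>A\<close> is the required set. If
  \<open>S\<close> has interior points, then the connected set \<open>interior A\<close> meets \<open>S\<close> but not \<open>frontier S\<close>,
  so it is contained in \<open>S\<close>; since a closed convex set with interior points is the closure of
  its interior, \<open>A = S\<close>, and \<open>S\<close> is \<open>r\<close>-strongly convex.
\<close>

definition ball_hull :: "real \<Rightarrow> 'a::real_inner set \<Rightarrow> 'a set" where
  "ball_hull r S = \<Inter>{cball c r | c. S \<subseteq> cball c r}"

lemma mem_ball_hull_iff: "x \<in> ball_hull r S \<longleftrightarrow> (\<forall>c. S \<subseteq> cball c r \<longrightarrow> x \<in> cball c r)"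
  unfolding ball_hull_def by blast

lemma subset_ball_hull: "S \<subseteq> ball_hull r S"
  unfolding ball_hull_def by blast

lemma closed_ball_hull: "closed (ball_hull r S)"
  unfolding ball_hull_def by (rule closed_Inter) auto

lemma convex_ball_hull: "convex (ball_hull r S)"
  unfolding ball_hull_def by (rule convex_Inter) auto

lemma far_realized_iff_subset_cball:
  fixes S :: "'a::real_inner set"
  assumes r: "r > 0" and z: "\<zeta> \<noteq> 0"
  shows "far_realized r S s \<zeta> \<longleftrightarrow> S \<subseteq> cball (s - r *\<^sub>R (\<zeta> /\<^sub>R norm \<zeta>)) r"
proof -
  define u where "u = \<zeta> /\<^sub>R norm \<zeta>"
  have u: "u \<bullet> u = 1"
    using z by (simp add: u_def dot_square_norm power2_eq_square)
  have "u \<bullet> (x - s) \<le> - (1 / (2 * r)) * (norm (x - s))\<^sup>2 \<longleftrightarrow> x \<in> cball (s - r *\<^sub>R u) r" for x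
  proof -
    have "x \<in> cball (s - r *\<^sub>R u) r \<longleftrightarrow> norm ((x - s) + r *\<^sub>R u) \<le> r"
      by (simp add: dist_norm norm_minus_commute algebra_simps)
    also have "\<dots> \<longleftrightarrow> (norm ((x - s) + r *\<^sub>R u))\<^sup>2 \<le> r\<^sup>2"
      using r by (simp add: power2_le_iff_abs_le)
    also have "(norm ((x - s) + r *\<^sub>R u))\<^sup>2 = (norm (x - s))\<^sup>2 + 2 * r * (u \<bullet> (x - s)) + r\<^sup>2"
      unfolding power2_norm_eq_inner inner_add_left inner_add_right
      by (simp add: u inner_commute power2_eq_square)
    also have "\<dots> \<le> r\<^sup>2 \<longleftrightarrow> u \<bullet> (x - s) \<le> - (1 / (2 * r)) * (norm (x - s))\<^sup>2"
      using r by (simp add: field_simps) linarith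
    finally show ?thesis by simp
  qed
  then show ?thesis
    by (auto simp: far_realized_def u_def)
qed

text \<open>
  On the segment from \<open>a\<close> to \<open>x\<close> the squared distance to the centre falls below \<open>r\<^sup>2\<close> by at
  least \<open>t (1 - t) (norm (x - a))\<^sup>2\<close>, by Stewart's identity. The distance itself then
  falls below \<open>r\<close> by at least \<open>t (1 - t) (norm (x - a))\<^sup>2 / (2 r)\<close>, which leaves room for the
  displacement by \<open>v\<close>.
\<close>

lemma bulged_segment_in_cball:
  fixes a x c v :: "'a::real_inner"
  assumes r: "r > 0" and a: "a \<in> cball c r" and x: "x \<in> cball c r"
    and t: "0 \<le> t" "t \<le> 1" and v: "norm v \<le> (norm (x - a))\<^sup>2 / (2 * r)"
  shows "a + t *\<^sub>R (x - a) + (t * (1 - t)) *\<^sub>R v \<in> cball c r"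
proof -
  define p where "p = a + t *\<^sub>R (x - a) - c"
  define k where "k = t * (1 - t)"
  define D where "D = (norm (x - a))\<^sup>2"
  have k: "k \<ge> 0" using t unfolding k_def by (intro mult_nonneg_nonneg) auto
  have na: "(norm (a - c))\<^sup>2 \<le> r\<^sup>2" and nx: "(norm (x - c))\<^sup>2 \<le> r\<^sup>2"
    using a x by (simp_all add: dist_norm norm_minus_commute power_mono)
  have "p = (1 - t) *\<^sub>R (a - c) + t *\<^sub>R (x - c)"
    by (simp add: p_def algebra_simps)
  moreover have "x - a = (x - c) - (a - c)" by simp
  ultimately have "(norm p)\<^sup>2 = (1 - t) * (norm (a - c))\<^sup>2 + t * (norm (x - c))\<^sup>2 - k * D"
    unfolding D_def k_def power2_norm_eq_inner
    by (simp only: inner_add_left inner_add_right inner_diff_left inner_diff_right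
        inner_scaleR_left inner_scaleR_right) (simp add: inner_commute algebra_simps)
  also have "\<dots> \<le> (1 - t) * r\<^sup>2 + t * r\<^sup>2 - k * D"
    using t na nx by (intro diff_right_mono add_mono mult_left_mono) auto
  finally have np: "(norm p)\<^sup>2 \<le> r\<^sup>2 - k * D"
    by (simp add: algebra_simps)
  have "k * D \<le> r\<^sup>2"
    using np zero_le_power2[of "norm p"] by linarith
  moreover have "0 \<le> r\<^sup>2" by simp
  ultimately have "k * D \<le> 2 * r\<^sup>2" by linarith
  then have pos: "0 \<le> r - k * D / (2 * r)"
    using r by (simp add: field_simps power2_eq_square)
  have "r\<^sup>2 - k * D \<le> (r - k * D / (2 * r))\<^sup>2"
    using r by (simp add: power2_diff)
  with np have "(norm p)\<^sup>2 \<le> (r - k * D / (2 * r))\<^sup>2"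
    by (rule order_trans)
  then have "norm p \<le> r - k * D / (2 * r)"
    using pos by (rule power2_le_imp_le)
  moreover have "norm (k *\<^sub>R v) \<le> k * (D / (2 * r))"
    using mult_left_mono[OF v k] k by (simp add: D_def)
  ultimately have "norm (p + k *\<^sub>R v) \<le> r"
    using norm_triangle_ineq[of p "k *\<^sub>R v"] by simp
  moreover have "c - (a + t *\<^sub>R (x - a) + (t * (1 - t)) *\<^sub>R v) = - (p + k *\<^sub>R v)"
    by (simp add: p_def k_def)
  ultimately show ?thesis
    by (simp only: mem_cball dist_norm norm_minus_cancel)
qed

text \<open>
  Suppose that \<open>x\<close> violates the far realization of a normal with direction \<open>u\<close> at \<open>a\<close>. Bulging
  the segment from \<open>a\<close> to \<open>x\<close> as far as possible in the direction \<open>u\<close> gives points of the hull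
  whose \<open>u\<close>-component over \<open>a\<close> grows linearly in the parameter \<open>t\<close>, with slope equal to the
  amount \<open>e > 0\<close> of the violation, whereas the proximal inequality only allows growth of
  order \<open>t\<^sup>2\<close>.
\<close>

theorem strongly_convex_ball_hull:
  fixes S :: "'a::real_inner set"
  assumes r: "r > 0"
  shows "strongly_convex r (ball_hull r S)"
  unfolding strongly_convex_def
proof (intro ballI impI)
  fix a \<zeta> :: 'a
  assume "a \<in> frontier (ball_hull r S)"
  then have a: "a \<in> ball_hull r S"
    using closed_ball_hull[of r S] frontier_subset_closed by blast
  assume "\<zeta> \<in> proximal_normal_cone (ball_hull r S) a" and z: "\<zeta> \<noteq> 0"
  then obtain \<sigma> where \<sigma>: "\<sigma> \<ge> 0"
    and prox: "\<And>y. y \<in> ball_hull r S \<Longrightarrow> \<zeta> \<bullet> (y - a) \<le> \<sigma> * (norm (y - a))\<^sup>2"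
    by (auto simp: proximal_normal_cone_def)
  define u where "u = \<zeta> /\<^sub>R norm \<zeta>"
  have nu: "norm u = 1" and zu: "\<zeta> = norm \<zeta> *\<^sub>R u"
    using z by (auto simp: u_def)
  show "far_realized r (ball_hull r S) a \<zeta>"
    unfolding far_realized_def u_def[symmetric]
  proof (intro ballI, rule ccontr)
    fix x
    assume x: "x \<in> ball_hull r S"
      and viol: "\<not> u \<bullet> (x - a) \<le> - (1 / (2 * r)) * (norm (x - a))\<^sup>2"
    define d where "d = x - a"
    define q where "q = (norm d)\<^sup>2 / (2 * r)"
    define e where "e = u \<bullet> d + q"
    have e: "e > 0" using viol by (simp add: e_def q_def d_def)
    have q: "q \<ge> 0" using r by (simp add: q_def)
    define K where "K = \<sigma> * (norm d + q)\<^sup>2 + norm \<zeta> * q"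
    have K: "K \<ge> 0" using \<sigma> q by (simp add: K_def)
    have ze: "norm \<zeta> * e > 0" using z e by simp
    \<comment> \<open>Any small \<open>t > 0\<close> would do; this one satisfies \<open>t * K < norm \<zeta> * e\<close> and \<open>t \<le> 1\<close>.\<close>
    define t where "t = norm \<zeta> * e / (norm \<zeta> * e + K)"
    have t: "0 < t" "t \<le> 1" using ze K by (auto simp: t_def)
    have tK: "t * K < norm \<zeta> * e"
    proof -
      have "t * (norm \<zeta> * e + K) = norm \<zeta> * e" using ze K by (simp add: t_def)
      moreover have "t * (norm \<zeta> * e) > 0" using t ze by simp
      ultimately show ?thesis by (simp add: distrib_left)
    qed
    define w where "w = d + ((1 - t) * q) *\<^sub>R u"
    have "a + t *\<^sub>R d + (t * (1 - t)) *\<^sub>R (q *\<^sub>R u) \<in> ball_hull r S"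
      unfolding mem_ball_hull_iff
    proof (intro allI impI)
      fix c assume "S \<subseteq> cball c r"
      then have "a \<in> cball c r" "x \<in> cball c r"
        using a x by (auto simp: mem_ball_hull_iff)
      then show "a + t *\<^sub>R d + (t * (1 - t)) *\<^sub>R (q *\<^sub>R u) \<in> cball c r"
        unfolding d_def using r t q nu
        by (intro bulged_segment_in_cball) (auto simp: q_def d_def)
    qed
    moreover have "a + t *\<^sub>R d + (t * (1 - t)) *\<^sub>R (q *\<^sub>R u) = a + t *\<^sub>R w"
      by (simp add: w_def scaleR_add_right mult_ac)
    ultimately have "a + t *\<^sub>R w \<in> ball_hull r S"
      by (simp only:)
    from prox[OF this] have "\<zeta> \<bullet> (t *\<^sub>R w) \<le> \<sigma> * (norm (t *\<^sub>R w))\<^sup>2"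
      by (simp only: add_diff_cancel_left')
    then have "t * (\<zeta> \<bullet> w) \<le> t * (t * (\<sigma> * (norm w)\<^sup>2))"
      by (simp add: power_mult_distrib power2_eq_square mult_ac)
    then have "\<zeta> \<bullet> w \<le> t * (\<sigma> * (norm w)\<^sup>2)"
      using t by simp
    also have "norm w \<le> norm d + q"
    proof -
      have "norm w \<le> norm d + (1 - t) * q"
        using norm_triangle_ineq[of d "((1 - t) * q) *\<^sub>R u"] t q nu by (simp add: w_def)
      moreover have "(1 - t) * q \<le> q" using t q by (simp add: mult_left_le_one_le)
      ultimately show ?thesis by linarith
    qed
    then have "t * (\<sigma> * (norm w)\<^sup>2) \<le> t * (\<sigma> * (norm d + q)\<^sup>2)"
      using t \<sigma> by (intro mult_left_mono power_mono) auto
    finally have upper: "\<zeta> \<bullet> w \<le> t * (\<sigma> * (norm d + q)\<^sup>2)" .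
    have "u \<bullet> u = 1" using nu by (simp add: dot_square_norm)
    then have "u \<bullet> w = e - t * q"
      by (simp add: w_def e_def inner_add_right algebra_simps)
    then have "\<zeta> \<bullet> w = norm \<zeta> * (e - t * q)"
      by (subst zu) simp
    then have "norm \<zeta> * e \<le> t * K"
      using upper by (simp add: K_def algebra_simps)
    then show False using tK by simp
  qed
qed

lemma frontier_subset_frontier_ball_hull:
  fixes S :: "'a::euclidean_space set"
  assumes r: "r > 0" and S: "closed S" and supp: "spherically_supported r S"
  shows "frontier S \<subseteq> frontier (ball_hull r S)"
proof
  fix s assume s: "s \<in> frontier S"
  then obtain \<zeta> where z: "\<zeta> \<noteq> 0" and far: "far_realized r S s \<zeta>"
    using supp by (auto simp: spherically_supported_def)
  define c where "c = s - r *\<^sub>R (\<zeta> /\<^sub>R norm \<zeta>)"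
  have "S \<subseteq> cball c r"
    using far far_realized_iff_subset_cball[OF r z] by (simp add: c_def)
  then have "ball_hull r S \<subseteq> cball c r"
    by (auto simp: mem_ball_hull_iff)
  then have "interior (ball_hull r S) \<subseteq> ball c r"
    using interior_mono interior_cball by blast
  moreover have "s \<notin> ball c r"
    using r z by (simp add: c_def dist_norm)
  moreover have "s \<in> closure (ball_hull r S)"
    using s S frontier_subset_closed subset_ball_hull[of S r] closure_subset by blast
  ultimately show "s \<in> frontier (ball_hull r S)"
    by (auto simp: frontier_def)
qed

text \<open>
  A connected set that meets \<open>S\<close> and avoids \<open>frontier S\<close> is contained in \<open>S\<close>; here it is the
  interior of the hull.
\<close>

lemma ball_hull_eq_self:
  fixes S :: "'a::euclidean_space set"
  assumes r: "r > 0" and S: "closed S" and supp: "spherically_supported r S"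
    and int: "interior S \<noteq> {}"
  shows "ball_hull r S = S"
proof
  let ?A = "ball_hull r S"
  have "interior S \<subseteq> interior ?A"
    by (rule interior_mono[OF subset_ball_hull])
  then have meets: "interior ?A \<inter> S \<noteq> {}" and A_int: "interior ?A \<noteq> {}"
    using int interior_subset[of S] by auto
  have "interior ?A \<inter> frontier S = {}"
    using frontier_subset_frontier_ball_hull[OF r S supp] by (auto simp: frontier_def)
  moreover have "connected (interior ?A)"
    by (intro convex_connected convex_interior convex_ball_hull)
  ultimately have "interior ?A \<subseteq> S"
    using meets connected_Int_frontier[of "interior ?A" S] by auto
  then have "closure (interior ?A) \<subseteq> S"
    using S by (rule closure_minimal)
  then show "?A \<subseteq> S"
    using convex_closure_interior[OF convex_ball_hull A_int] closed_ball_hull[of r S] by simp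
qed (rule subset_ball_hull)

theorem theorem3:
  fixes S :: "(real ^ 'n) set" and r :: real
  assumes "r > 0" and "S \<noteq> {}" and "closed S" and "spherically_supported r S"
  shows "(strongly_convex r S \<or>
           (\<exists>A :: (real ^ 'n) set. A \<noteq> {} \<and> closed A \<and> strongly_convex r A \<and> S \<subseteq> frontier A)) \<and>
         (interior S \<noteq> {} \<longrightarrow> strongly_convex r S) \<and>
         (interior S = {} \<longrightarrow>
           (\<exists>A :: (real ^ 'n) set. A \<noteq> {} \<and> closed A \<and> strongly_convex r A \<and> S \<subseteq> frontier A))"
proof -
  have hull: "strongly_convex r (ball_hull r S)"
    using \<open>r > 0\<close> by (rule strongly_convex_ball_hull)
  have solid: "strongly_convex r S" if "interior S \<noteq> {}"
    using hull ball_hull_eq_self[OF assms(1,3,4) that] by simp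
  have thin: "\<exists>A :: (real ^ 'n) set. A \<noteq> {} \<and> closed A \<and> strongly_convex r A \<and> S \<subseteq> frontier A"
    if "interior S = {}"
  proof (intro exI conjI)
    show "ball_hull r S \<noteq> {}"
      using \<open>S \<noteq> {}\<close> subset_ball_hull[of S r] by auto
    have "frontier S = S"
      using that \<open>closed S\<close> by (simp add: frontier_def)
    then show "S \<subseteq> frontier (ball_hull r S)"
      using frontier_subset_frontier_ball_hull[OF assms(1,3,4)] by simp
  qed (rule closed_ball_hull hull)+
  show ?thesis
    using solid thin by blast
qed

end
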